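(* Let $\mu_1,\lambda_1\in\mathbb{R}$, $\omega_1>0$, let $f_1$ be the pdf of $SN(\mu_1,\omega_1,\lambda_1)$, and let $\Gamma_1$ be the value of $\Gamma$ for the parameters $(\mu_1,\omega_1,\lambda_1)$. Let $$\mathcal{P}_0=\{SN(\mu,\omega,\lambda):\ \mu,\lambda\in\mathbb{R},\ \omega>0,\ \Gamma\neq\Gamma_1\}.$$ Then the family of mixture pdfs $\mathcal{F}(\mathcal{P}_0,f_1)$ is identifiable.
   Context: Univariate skew normal family: for $\mu,\lambda\in\mathbb{R}$ and $\omega>0$, $SN(\mu,\omega,\lambda)$ is the distribution on $\mathbb{R}$ with pdf $\frac{2}{\omega}\phi\left(\frac{x-\mu}{\omega}\right)\Phi\left(\frac{\lambda(x-\mu)}{\omega}\right)$, where $\phi,\Phi$ are the pdf and cdf of the standard normal distribution; distributions are identified with their pdfs. Associated quantities: $\delta=\lambda/\sqrt{1+\lambda^2}$ and $\Gamma=\omega^2(1-\delta^2)$. Mixtures with one known component: for a set $\mathcal{P}_0$ of pdfs on $\mathbb{R}^K$ (here $K=1$) and a fixed pdf $f_1$ on $\mathbb{R}^K$, put $f(\alpha,f_0)=\alpha f_1+(1-\alpha)f_0$ for $\alpha\in(0,1)$, $f_0\in\mathcal{P}_0$, and $\mathcal{F}(\mathcal{P}_0,f_1)=\{f(\alpha,f_0):\alpha\in(0,1),f_0\in\mathcal{P}_0\}$. The family $\mathcal{F}(\mathcal{P}_0,f_1)$ is identifiable if for all $a,b\in(0,1)$ and all $h_0,g_0\in\mathcal{P}_0$,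 $f(a,h_0)=f(b,g_0)$ implies $(a,h_0)=(b,g_0)$. *)

theory Defs
  imports "HOL-Probability.Probability"
begin

definition skew_normal_pdf :: "real \<Rightarrow> real \<Rightarrow> real \<Rightarrow> real \<Rightarrow> real" where
  "skew_normal_pdf \<mu> \<omega> l x =
     2 / \<omega> * std_normal_density ((x - \<mu>) / \<omega>)
       * cdf std_normal_distribution (l * (x - \<mu>) / \<omega>)"

definition skew_normal_delta :: "real \<Rightarrow> real" where
  "skew_normal_delta l = l / sqrt (1 + l\<^sup>2)"

definition skew_normal_Gamma :: "real \<Rightarrow> real \<Rightarrow> real" where
  "skew_normal_Gamma \<omega> l = \<omega>\<^sup>2 * (1 - (skew_normal_delta l)\<^sup>2)"

definition mixture :: "('a::euclidean_space \<Rightarrow> real) \<Rightarrow> real \<Rightarrow> ('a \<Rightarrow> real) \<Rightarrow> 'a \<Rightarrow> real" where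
  "mixture f1 \<alpha> f0 = (\<lambda>x. \<alpha> * f1 x + (1 - \<alpha>) * f0 x)"

text \<open>Identifiability is a property of the parametrization \<open>(\<alpha>, f0) \<mapsto> \<alpha> f1 + (1 - \<alpha>) f0\<close> of the
  mixture family, so it is stated for the pair \<open>P0\<close>, \<open>f1\<close> and not for the set of mixtures.\<close>

definition identifiable_mixtures :: "('a::euclidean_space \<Rightarrow> real) set \<Rightarrow> ('a \<Rightarrow> real) \<Rightarrow> bool" where
  "identifiable_mixtures P0 f1 \<longleftrightarrow>
     (\<forall>a\<in>{0<..<1}. \<forall>b\<in>{0<..<1}. \<forall>h0\<in>P0. \<forall>g0\<in>P0.
        mixture f1 a h0 = mixture f1 b g0 \<longrightarrow> (a, h0) = (b, g0))"

end

theory Submission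
  imports Defs "HOL-Real_Asymp.Real_Asymp"
begin

text \<open>
  If \<open>a f\<^sub>1 + (1 - a) h = b f\<^sub>1 + (1 - b) g\<close> with \<open>a < b\<close>, then \<open>h\<close> is a proper convex combination
  of \<open>f\<^sub>1\<close> and \<open>g\<close>. By the asymptotics of the Mills ratio, a skew normal density has one tail
  governed by \<open>\<omega>\<^sup>2\<close> and the other by \<open>\<Gamma>\<close> (with an extra factor \<open>1 / x\<close>), and the two tails together
  determine the parameters. On each side at least one of \<open>f\<^sub>1\<close>, \<open>g\<close> has a tail of the same order
  as that of \<open>h\<close>. If the same density does so on both sides, it equals \<open>h\<close>, hence all three densities
  are equal. Otherwise \<open>f\<^sub>1\<close> provides one tail of \<open>h\<close> and \<open>g\<close> the other; the leading
  coefficients then force \<open>h\<close> to be normal and \<open>f\<^sub>1\<close>, \<open>g\<close> to be mirror images of each other. In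
  all cases \<open>\<Gamma>\<^sub>1\<close> equals the \<open>\<Gamma>\<close> of \<open>g\<close> or \<open>h\<close>.
\<close>

section \<open>The standard normal distribution function and its Mills ratio\<close>

abbreviation std_normal_cdf :: "real \<Rightarrow> real" where
  "std_normal_cdf \<equiv> cdf std_normal_distribution"

interpretation std_normal: real_distribution std_normal_distribution
  by (rule real_dist_normal_dist)

lemma std_normal_density_has_derivative:
  "(std_normal_density has_real_derivative - x * std_normal_density x) (at x)"
proof -
  have "((\<lambda>x. K * exp (- x\<^sup>2 / 2)) has_real_derivative - x * (K * exp (- x\<^sup>2 / 2))) (at x)" for K
    by (auto intro!: derivative_eq_intros)
  then show ?thesis unfolding std_normal_density_def .
qed

text \<open>Fundamental theorem of calculus for the continuous density. Integrating from
  \<open>x - 1\<close> keeps the integrals on a compact interval with \<open>x\<close> in its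
  interior, so the derivative is two-sided.\<close>

lemma std_normal_cdf_has_derivative:
  "(std_normal_cdf has_real_derivative std_normal_density x) (at x)"
proof -
  let ?a = "x - 1" and ?b = "x + 1"
  have eq: "std_normal_cdf y = std_normal_cdf ?a + integral {?a..y} std_normal_density"
    if "y \<in> {?a<..<?b}" for y
  proof -
    have int: "set_integrable lborel {?a<..y} std_normal_density"
      unfolding set_integrable_def
      by (intro integrable_mult_indicator) (auto intro: integrable_normal_density)
    have "std_normal_cdf y - std_normal_cdf ?a = measure std_normal_distribution {?a<..y}"
      using that by (intro std_normal.cdf_diff_eq) auto
    also have "\<dots> = (LINT t|std_normal_distribution. indicator {?a<..y} t)"
      by simp
    also have "\<dots> = (LINT t:{?a<..y}|lborel. std_normal_density t)"
      unfolding set_lebesgue_integral_def by (subst integral_density) (auto simp: mult.commute)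
    also have "\<dots> = integral {?a<..y} std_normal_density"
      using int by (rule set_borel_integral_eq_integral)
    also have "\<dots> = integral {?a..y} std_normal_density"
      using that by (intro integral_spike_set; intro negligible_subset[OF negligible_sing[of ?a]]) auto
    finally show ?thesis by simp
  qed
  have "((\<lambda>y. std_normal_cdf ?a + integral {?a..y} std_normal_density)
      has_real_derivative std_normal_density x) (at x within {?a..?b})"
    by (auto intro!: derivative_eq_intros integral_has_real_derivative
          simp: std_normal_density_def continuous_intros)
  then have "((\<lambda>y. std_normal_cdf ?a + integral {?a..y} std_normal_density)
      has_real_derivative std_normal_density x) (at x)"
    by (simp add: at_within_Icc_at)
  then show ?thesis
    by (rule has_field_derivative_transform_within_open[where S = "{?a<..<?b}"]) (auto simp: eq)
qed

lemma std_normal_cdf_pos: "std_normal_cdf x > 0"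
proof -
  have "std_normal_cdf (x - 1) < std_normal_cdf x"
    by (rule DERIV_pos_imp_increasing)
      (auto intro!: exI std_normal_cdf_has_derivative simp: normal_density_pos)
  then show ?thesis
    using std_normal.cdf_nonneg[of "x - 1"] by linarith
qed

text \<open>L'Hopital's rule after substituting \<open>t = inverse s\<close>: the derivatives of
  numerator and denominator have quotient \<open>1 / (1 + s ^ 2)\<close>, which tends to 1.\<close>

lemma mills_ratio:
  "((\<lambda>t. std_normal_cdf (- t) / (std_normal_density t / t)) \<longlongrightarrow> 1) at_top"
proof -
  have "((\<lambda>s. std_normal_cdf (- inverse s) / (std_normal_density (inverse s) * s)) \<longlongrightarrow> 1) (at_right 0)"
  proof (rule lhopital_right)
    have "filterlim (\<lambda>s::real. - inverse s) at_bot (at_right 0)"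
      by real_asymp
    then show "((\<lambda>s. std_normal_cdf (- inverse s)) \<longlongrightarrow> 0) (at_right 0)"
      by (rule filterlim_compose[OF std_normal.cdf_lim_at_bot])
    show "((\<lambda>s. std_normal_density (inverse s) * s) \<longlongrightarrow> 0) (at_right 0)"
      unfolding std_normal_density_def by real_asymp
    show "\<forall>\<^sub>F s in at_right 0. std_normal_density (inverse s) * s \<noteq> 0"
      by (auto simp: eventually_at_right_less std_normal_density_def
          intro!: eventually_mono[OF eventually_at_right_less[of 0]])
    show "\<forall>\<^sub>F s in at_right 0. std_normal_density (inverse s) * (1 + inverse s ^ 2) \<noteq> 0"
      by (auto simp: std_normal_density_def add_pos_pos less_imp_neq[symmetric]
          intro!: eventually_mono[OF eventually_at_right_less[of 0]])
    show "\<forall>\<^sub>F s in at_right 0. ((\<lambda>s. std_normal_cdf (- inverse s))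
        has_real_derivative std_normal_density (inverse s) * inverse s ^ 2) (at s)"
    proof (rule eventually_mono[OF eventually_at_right_less[of 0]])
      fix s :: real assume "0 < s"
      then have "((\<lambda>s. - inverse s) has_real_derivative inverse s ^ 2) (at s)"
        by (auto intro!: derivative_eq_intros simp: power2_eq_square)
      from DERIV_chain2[OF std_normal_cdf_has_derivative this]
      show "((\<lambda>s. std_normal_cdf (- inverse s))
          has_real_derivative std_normal_density (inverse s) * inverse s ^ 2) (at s)"
        by (simp add: std_normal_density_def[of "- _"] std_normal_density_def[of "inverse _"])
    qed
    show "\<forall>\<^sub>F s in at_right 0. ((\<lambda>s. std_normal_density (inverse s) * s)
        has_real_derivative std_normal_density (inverse s) * (1 + inverse s ^ 2)) (at s)"
    proof (rule eventually_mono[OF eventually_at_right_less[of 0]])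
      fix s :: real assume "0 < s"
      then show "((\<lambda>s. std_normal_density (inverse s) * s)
          has_real_derivative std_normal_density (inverse s) * (1 + inverse s ^ 2)) (at s)"
        by (auto intro!: derivative_eq_intros DERIV_chain2[OF std_normal_density_has_derivative]
            simp: power2_eq_square algebra_simps)
    qed
    show "((\<lambda>s. (std_normal_density (inverse s) * inverse s ^ 2)
        / (std_normal_density (inverse s) * (1 + inverse s ^ 2))) \<longlongrightarrow> 1) (at_right 0)"
      unfolding std_normal_density_def by real_asymp
  qed
  then show ?thesis
    by (subst filterlim_at_top_to_right) (simp add: divide_inverse)
qed

section \<open>Comparison of Gaussian tails\<close>

text \<open>The triple holds the power of \<open>x\<close> in the denominator, the variance and the
  centre. Constant factors are left out, so a triple stands for an order of decay and leading
  coefficients are recorded separately.\<close>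

definition gaussian_tail :: "nat \<times> real \<times> real \<Rightarrow> real \<Rightarrow> real" where
  "gaussian_tail = (\<lambda>(k, V, m) x. exp (- (x - m)\<^sup>2 / (2 * V)) / x ^ k)"

text \<open>The quotient is the exponential of a quadratic polynomial times a power of
  \<open>x\<close>. The first nonzero number among \<open>p\<close>, \<open>q\<close> and
  \<open>l - k\<close> decides its limit; if all three vanish, then V = W, hence m = n, and the
  triples agree.\<close>

lemma gaussian_tail_ratio:
  assumes "fst (snd s) > 0" "fst (snd t) > 0" "s \<noteq> t"
  shows "((\<lambda>x. gaussian_tail s x / gaussian_tail t x) \<longlongrightarrow> 0) at_top \<or>
    filterlim (\<lambda>x. gaussian_tail s x / gaussian_tail t x) at_top at_top"
proof -
  obtain k V m l W n where st: "s = (k, V, m)" "t = (l, W, n)"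
    by (cases s, cases t)
  have VW: "V > 0" "W > 0" using assms st by auto
  define p where "p = 1 / (2 * W) - 1 / (2 * V)"
  define q where "q = m / V - n / W"
  define r where "r = n\<^sup>2 / (2 * W) - m\<^sup>2 / (2 * V)"
  \<comment> \<open>The real power covers both signs of \<open>l - k\<close>.\<close>
  define G where "G = (\<lambda>x::real. exp (p * x\<^sup>2 + q * x + r) * x powr (real l - real k))"
  have "gaussian_tail s x / gaussian_tail t x = G x" if "x > 0" for x
  proof -
    have e: "p * x\<^sup>2 + q * x + r = - (x - m)\<^sup>2 / (2 * V) - (- (x - n)\<^sup>2 / (2 * W))"
      using VW unfolding p_def q_def r_def
      by (simp add: field_simps) (simp add: algebra_simps power2_eq_square)
    show ?thesis
      using that unfolding st gaussian_tail_def G_def e exp_diff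
      by (simp add: powr_diff powr_realpow)
  qed
  then have eq: "\<forall>\<^sub>F x in at_top. G x = gaussian_tail s x / gaussian_tail t x"
    by (intro eventually_mono[OF eventually_gt_at_top[of 0]]) simp
  have "(G \<longlongrightarrow> 0) at_top \<or> filterlim G at_top at_top"
  proof -
    consider "p > 0" | "p < 0" | "p = 0" "q > 0" | "p = 0" "q < 0"
      | "p = 0" "q = 0" "k < l" | "p = 0" "q = 0" "k > l" | "p = 0" "q = 0" "k = l"
      by linarith
    then show ?thesis
    proof cases
      case 1
      have "filterlim G at_top at_top" unfolding G_def using 1 by real_asymp
      then show ?thesis ..
    next
      case 2
      have "(G \<longlongrightarrow> 0) at_top" unfolding G_def using 2 by real_asymp
      then show ?thesis ..
    next
      case 3
      have "filterlim G at_top at_top" unfolding G_def 3(1) using 3(2) by real_asymp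
      then show ?thesis ..
    next
      case 4
      have "(G \<longlongrightarrow> 0) at_top" unfolding G_def 4(1) using 4(2) by real_asymp
      then show ?thesis ..
    next
      case 5
      define d where "d = real l - real k"
      have "d > 0" using 5 by (simp add: d_def)
      then have "filterlim G at_top at_top"
        unfolding G_def 5(1,2) d_def[symmetric] by real_asymp
      then show ?thesis ..
    next
      case 6
      define d where "d = real l - real k"
      have "d < 0" using 6 by (simp add: d_def)
      then have "(G \<longlongrightarrow> 0) at_top"
        unfolding G_def 6(1,2) d_def[symmetric] by real_asymp
      then show ?thesis ..
    next
      case 7
      have "V = W" using 7(1) VW by (simp add: p_def)
      moreover from this have "m = n" using 7(2) VW by (simp add: q_def)
      ultimately show ?thesis using 7(3) assms(3) st by simp
    qed
  qed
  then show ?thesis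
    using eq by (auto intro: Lim_transform_eventually filterlim_mono_eventually)
qed

lemma gaussian_tail_pos: "x > 0 \<Longrightarrow> gaussian_tail s x > 0"
  by (cases s) (simp add: gaussian_tail_def)

text \<open>If the shapes differ, \<open>f\<close> is either negligible against the tail
  \<open>t\<close> or dominates it. Domination would carry over to \<open>F\<close> through
  \<open>c * f x \<le> F x\<close>, contradicting the finite limit \<open>D\<close>.\<close>

lemma tail_summand:
  fixes f F :: "real \<Rightarrow> real"
  assumes f: "((\<lambda>x. f x / gaussian_tail s x) \<longlongrightarrow> C) at_top" "C > 0"
    and F: "((\<lambda>x. F x / gaussian_tail t x) \<longlongrightarrow> D) at_top"
    and V: "fst (snd s) > 0" "fst (snd t) > 0"
    and c: "c > 0" and le: "\<And>x. c * f x \<le> F x"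
  shows "((\<lambda>x. f x / gaussian_tail t x) \<longlongrightarrow> (if s = t then C else 0)) at_top"
proof (cases "s = t")
  case True
  then show ?thesis using f by simp
next
  case False
  have eq: "\<forall>\<^sub>F x in at_top.
      f x / gaussian_tail s x * (gaussian_tail s x / gaussian_tail t x) = f x / gaussian_tail t x"
    by (rule eventually_mono[OF eventually_gt_at_top[of 0]])
      (simp add: less_imp_neq[OF gaussian_tail_pos, symmetric])
  from gaussian_tail_ratio[OF V False] show ?thesis
  proof
    assume "((\<lambda>x. gaussian_tail s x / gaussian_tail t x) \<longlongrightarrow> 0) at_top"
    from tendsto_mult[OF f(1) this] show ?thesis
      using eq False by (auto intro: Lim_transform_eventually)
  next
    assume "filterlim (\<lambda>x. gaussian_tail s x / gaussian_tail t x) at_top at_top"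
    then have "filterlim (\<lambda>x. f x / gaussian_tail s x * (gaussian_tail s x / gaussian_tail t x)) at_top at_top"
      by (rule filterlim_tendsto_pos_mult_at_top[OF f])
    then have "filterlim (\<lambda>x. f x / gaussian_tail t x) at_top at_top"
      using eq by (auto intro: filterlim_mono_eventually)
    then have "filterlim (\<lambda>x. c * (f x / gaussian_tail t x)) at_top at_top"
      by (rule filterlim_tendsto_pos_mult_at_top[OF tendsto_const c])
    then have "filterlim (\<lambda>x. F x / gaussian_tail t x) at_top at_top"
    proof (rule filterlim_at_top_mono)
      show "\<forall>\<^sub>F x in at_top. c * (f x / gaussian_tail t x) \<le> F x / gaussian_tail t x"
        by (rule eventually_mono[OF eventually_gt_at_top[of 0]])
          (simp add: le divide_right_mono less_imp_le[OF gaussian_tail_pos])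
    qed
    with F show ?thesis
      using not_tendsto_and_filterlim_at_infinity[OF _ F] filterlim_at_top_imp_at_infinity
      by auto
  qed
qed

text \<open>Nonnegativity bounds each weighted summand by \<open>h\<close>, so no cancellation can
  hide a heavier tail. Dividing by the tail of \<open>h\<close> and passing to the limit leaves only
  the summands of the same shape.\<close>

lemma tail_of_sum:
  fixes f g h :: "real \<Rightarrow> real"
  assumes f: "((\<lambda>x. f x / gaussian_tail s x) \<longlongrightarrow> C) at_top" "C > 0" "fst (snd s) > 0"
    and g: "((\<lambda>x. g x / gaussian_tail t x) \<longlongrightarrow> D) at_top" "D > 0" "fst (snd t) > 0"
    and h: "((\<lambda>x. h x / gaussian_tail u x) \<longlongrightarrow> E) at_top" "fst (snd u) > 0"
    and "c > 0" "d > 0" "\<And>x. f x \<ge> 0" "\<And>x. g x \<ge> 0"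
    and eq: "\<And>x. c * f x + d * g x = h x"
  shows "c * (if s = u then C else 0) + d * (if t = u then D else 0) = E"
proof -
  have "c * f x \<le> h x" "d * g x \<le> h x" for x
    using assms(9-12) by (auto simp flip: eq)
  then have "((\<lambda>x. f x / gaussian_tail u x) \<longlongrightarrow> (if s = u then C else 0)) at_top"
    and "((\<lambda>x. g x / gaussian_tail u x) \<longlongrightarrow> (if t = u then D else 0)) at_top"
    using assms by (blast intro: tail_summand)+
  then have "((\<lambda>x. c * (f x / gaussian_tail u x) + d * (g x / gaussian_tail u x))
      \<longlongrightarrow> c * (if s = u then C else 0) + d * (if t = u then D else 0)) at_top"
    by (intro tendsto_intros)
  also have "(\<lambda>x. c * (f x / gaussian_tail u x) + d * (g x / gaussian_tail u x))
      = (\<lambda>x. h x / gaussian_tail u x)"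
    by (simp add: add_divide_distrib flip: eq)
  finally show ?thesis
    using h(1) by (intro tendsto_unique[of "at_top :: real filter"]) auto
qed

section \<open>Tails of the skew normal densities\<close>

lemma skew_normal_Gamma_eq: "skew_normal_Gamma \<omega> l = \<omega>\<^sup>2 / (1 + l\<^sup>2)"
proof -
  have "1 + l\<^sup>2 > 0" by (simp add: add_pos_nonneg)
  then show ?thesis
    unfolding skew_normal_Gamma_def skew_normal_delta_def
    by (simp add: power_divide field_simps)
qed

text \<open>The leading term of the skew normal density at \<open>+\<infinity>\<close>. For \<open>l < 0\<close> the factor
  \<open>\<Phi>(l z)\<close> decays like \<open>\<phi>(l z) / (- l z)\<close>, which turns the variance \<open>\<omega>\<^sup>2\<close> into \<open>\<Gamma>\<close>.
  The left tail is the right tail for the parameters \<open>(- \<mu>, \<omega>, - l)\<close>.\<close>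

definition sn_tail_shape :: "real \<Rightarrow> real \<Rightarrow> real \<Rightarrow> nat \<times> real \<times> real" where
  "sn_tail_shape \<mu> \<omega> l = (if l < 0 then (1, skew_normal_Gamma \<omega> l, \<mu>) else (0, \<omega>\<^sup>2, \<mu>))"

text \<open>For \<open>l \<ge> 0\<close> the factor is the limit of
  \<open>std_normal_cdf (l * z)\<close>, which jumps at \<open>l = 0\<close>. For
  \<open>l < 0\<close> the constant is 2 / \<omega> times 1 / (2 pi) from the two normal densities
  times \<omega> / (- l) from the Mills ratio.\<close>

definition sn_tail_coeff :: "real \<Rightarrow> real \<Rightarrow> real" where
  "sn_tail_coeff \<omega> l =
    (if l < 0 then 1 / (pi * - l)
     else 2 / (\<omega> * sqrt (2 * pi)) * (if l = 0 then std_normal_cdf 0 else 1))"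

lemma sn_tail_shape_pos: "\<omega> > 0 \<Longrightarrow> fst (snd (sn_tail_shape \<mu> \<omega> l)) > 0"
  by (simp add: sn_tail_shape_def skew_normal_Gamma_eq add_pos_nonneg)

lemma sn_tail_coeff_pos: "\<omega> > 0 \<Longrightarrow> sn_tail_coeff \<omega> l > 0"
  by (simp add: sn_tail_coeff_def std_normal_cdf_pos divide_pos_neg mult_pos_neg)

lemma skew_normal_pdf_nonneg: "\<omega> > 0 \<Longrightarrow> skew_normal_pdf \<mu> \<omega> l x \<ge> 0"
  unfolding skew_normal_pdf_def by (intro mult_nonneg_nonneg std_normal.cdf_nonneg) auto

lemma skew_normal_pdf_tail:
  assumes "\<omega> > 0"
  shows "((\<lambda>x. skew_normal_pdf \<mu> \<omega> l x / gaussian_tail (sn_tail_shape \<mu> \<omega> l) x)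
    \<longlongrightarrow> sn_tail_coeff \<omega> l) at_top"
proof (cases "l < 0")
  case False
  have eq: "skew_normal_pdf \<mu> \<omega> l x / gaussian_tail (sn_tail_shape \<mu> \<omega> l) x
      = 2 / (\<omega> * sqrt (2 * pi)) * std_normal_cdf (l * (x - \<mu>) / \<omega>)" for x
    using assms False
    by (simp add: skew_normal_pdf_def gaussian_tail_def sn_tail_shape_def std_normal_density_def
        power_divide field_simps)
  have "((\<lambda>x. std_normal_cdf (l * (x - \<mu>) / \<omega>)) \<longlongrightarrow> (if l = 0 then std_normal_cdf 0 else 1)) at_top"
  proof (cases "l = 0")
    case l: False
    with False have "l > 0" by simp
    then have "filterlim (\<lambda>x. l * (x - \<mu>) / \<omega>) at_top at_top"
      using assms by real_asymp
    then show ?thesis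
      using l by (auto intro: filterlim_compose[OF std_normal.cdf_lim_at_top_prob])
  qed simp
  from tendsto_mult_left[OF this, of "2 / (\<omega> * sqrt (2 * pi))"] show ?thesis
    unfolding eq using False by (simp add: sn_tail_coeff_def)
next
  case True
  define t where "t = (\<lambda>x. - l * (x - \<mu>) / \<omega>)"
  have "filterlim (\<lambda>x. k * (x - \<mu>) / \<omega>) at_top at_top" if "k > 0" for k
    using that assms by real_asymp
  from this[of "- l"] have "filterlim t at_top at_top"
    using True by (simp add: t_def)
  from filterlim_compose[OF mills_ratio this]
  \<comment> \<open>The Mills ratio yields a denominator \<open>x - \<mu>\<close>, whereas
    \<open>gaussian_tail\<close> has \<open>x\<close>; the factor \<open>x / (x - \<mu>)\<close>
    converts one into the other.\<close>
  have "((\<lambda>x. 1 / (pi * - l) * (x / (x - \<mu>)) * (std_normal_cdf (- t x) / (std_normal_density (t x) / t x)))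
      \<longlongrightarrow> 1 / (pi * - l) * 1 * 1) at_top"
    by (intro tendsto_mult tendsto_const) real_asymp+
  moreover have "\<forall>\<^sub>F x in at_top.
      1 / (pi * - l) * (x / (x - \<mu>)) * (std_normal_cdf (- t x) / (std_normal_density (t x) / t x))
      = skew_normal_pdf \<mu> \<omega> l x / gaussian_tail (sn_tail_shape \<mu> \<omega> l) x"
    using eventually_gt_at_top[of "max 0 \<mu>"]
  proof eventually_elim
    case (elim x)
    have t2: "(t x)\<^sup>2 = l\<^sup>2 * (x - \<mu>)\<^sup>2 / \<omega>\<^sup>2"
      by (simp only: t_def power_divide power_mult_distrib power2_minus)
    have L: "1 + l\<^sup>2 > 0" by (simp add: add_pos_nonneg)
    have "- (x - \<mu>)\<^sup>2 / (2 * skew_normal_Gamma \<omega> l) = - ((x - \<mu>) / \<omega>)\<^sup>2 / 2 + - (t x)\<^sup>2 / 2"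
      using assms L unfolding skew_normal_Gamma_eq t2
      by (simp add: power_divide field_simps)
    then have "gaussian_tail (sn_tail_shape \<mu> \<omega> l) x
        = exp (- ((x - \<mu>) / \<omega>)\<^sup>2 / 2) * exp (- (t x)\<^sup>2 / 2) / x"
      using True by (simp add: gaussian_tail_def sn_tail_shape_def flip: exp_add)
    moreover have "- t x = l * (x - \<mu>) / \<omega>" by (simp add: t_def)
    \<comment> \<open>With the exponentials and \<open>sqrt (2 * pi)\<close> abstracted to positive
      variables this is a rational identity; \<open>r * r / 2\<close> becomes
      \<open>pi\<close>.\<close>
    moreover have "1 / (r * r / 2 * - l) * (x / y) * (P / (1 / r * e / (- l * y / \<omega>)))
        = 2 / \<omega> * (1 / r * e') * P / (e' * e / x)"
      if "r > 0" "y > 0" "e > 0" "e' > 0" for r y e e' P :: real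
      using that elim assms True by (simp add: field_simps)
    from this[of "sqrt (2 * pi)" "x - \<mu>" "exp (- (t x)\<^sup>2 / 2)" "exp (- ((x - \<mu>) / \<omega>)\<^sup>2 / 2)"
        "std_normal_cdf (- t x)"]
    have "1 / (pi * - l) * (x / (x - \<mu>)) * (std_normal_cdf (- t x) / (std_normal_density (t x) / t x))
        = 2 / \<omega> * std_normal_density ((x - \<mu>) / \<omega>) * std_normal_cdf (- t x)
          / (exp (- ((x - \<mu>) / \<omega>)\<^sup>2 / 2) * exp (- (t x)\<^sup>2 / 2) / x)"
      using elim by (simp add: std_normal_density_def t_def)
    ultimately show ?case
      by (simp add: skew_normal_pdf_def)
  qed
  ultimately show ?thesis
    using True by (auto simp: sn_tail_coeff_def intro: Lim_transform_eventually)
qed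


lemma skew_normal_pdf_uminus:
  "skew_normal_pdf \<mu> \<omega> l (- x) = skew_normal_pdf (- \<mu>) \<omega> (- l) x"
proof -
  have "(- x - \<mu>) / \<omega> = - ((x - - \<mu>) / \<omega>)" "l * (- x - \<mu>) / \<omega> = - l * (x - - \<mu>) / \<omega>"
    by (simp_all add: divide_inverse algebra_simps)
  then show ?thesis
    unfolding skew_normal_pdf_def std_normal_density_def by (simp only: power2_minus)
qed

section \<open>Both tails of a mixture, and recovery of the parameters\<close>

lemma skew_normal_mixture_right_tail:
  assumes "\<omega>\<^sub>1 > 0" "\<omega>\<^sub>2 > 0" "\<omega>\<^sub>3 > 0" "c > 0" "d > 0"
    and "\<And>x. c * skew_normal_pdf \<mu>\<^sub>1 \<omega>\<^sub>1 l\<^sub>1 x + d * skew_normal_pdf \<mu>\<^sub>2 \<omega>\<^sub>2 l\<^sub>2 x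
      = skew_normal_pdf \<mu>\<^sub>3 \<omega>\<^sub>3 l\<^sub>3 x"
  shows "c * (if sn_tail_shape \<mu>\<^sub>1 \<omega>\<^sub>1 l\<^sub>1 = sn_tail_shape \<mu>\<^sub>3 \<omega>\<^sub>3 l\<^sub>3 then sn_tail_coeff \<omega>\<^sub>1 l\<^sub>1 else 0)
    + d * (if sn_tail_shape \<mu>\<^sub>2 \<omega>\<^sub>2 l\<^sub>2 = sn_tail_shape \<mu>\<^sub>3 \<omega>\<^sub>3 l\<^sub>3 then sn_tail_coeff \<omega>\<^sub>2 l\<^sub>2 else 0)
    = sn_tail_coeff \<omega>\<^sub>3 l\<^sub>3"
  by (rule tail_of_sum[OF skew_normal_pdf_tail sn_tail_coeff_pos sn_tail_shape_pos
        skew_normal_pdf_tail sn_tail_coeff_pos sn_tail_shape_pos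
        skew_normal_pdf_tail sn_tail_shape_pos])
    (use assms in \<open>auto simp: skew_normal_pdf_nonneg\<close>)

lemma skew_normal_mixture_left_tail:
  assumes "\<omega>\<^sub>1 > 0" "\<omega>\<^sub>2 > 0" "\<omega>\<^sub>3 > 0" "c > 0" "d > 0"
    and eq: "\<And>x. c * skew_normal_pdf \<mu>\<^sub>1 \<omega>\<^sub>1 l\<^sub>1 x + d * skew_normal_pdf \<mu>\<^sub>2 \<omega>\<^sub>2 l\<^sub>2 x
      = skew_normal_pdf \<mu>\<^sub>3 \<omega>\<^sub>3 l\<^sub>3 x"
  shows "c * (if sn_tail_shape (- \<mu>\<^sub>1) \<omega>\<^sub>1 (- l\<^sub>1) = sn_tail_shape (- \<mu>\<^sub>3) \<omega>\<^sub>3 (- l\<^sub>3)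
        then sn_tail_coeff \<omega>\<^sub>1 (- l\<^sub>1) else 0)
    + d * (if sn_tail_shape (- \<mu>\<^sub>2) \<omega>\<^sub>2 (- l\<^sub>2) = sn_tail_shape (- \<mu>\<^sub>3) \<omega>\<^sub>3 (- l\<^sub>3)
        then sn_tail_coeff \<omega>\<^sub>2 (- l\<^sub>2) else 0)
    = sn_tail_coeff \<omega>\<^sub>3 (- l\<^sub>3)"
  by (rule skew_normal_mixture_right_tail) (use assms eq[of "- _"] in \<open>auto simp: skew_normal_pdf_uminus\<close>)

text \<open>The exponent of \<open>x\<close> is 1 on the right exactly for \<open>l < 0\<close> and
  on the left exactly for \<open>l > 0\<close>, so the two shapes reveal the sign of
  \<open>l\<close>. A side with exponent 0 gives \<omega>; the other gives \<Gamma> and thereby the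
  square of \<open>l\<close>.\<close>

lemma sn_tail_shapes_inj:
  assumes "\<omega> > 0" "\<omega>' > 0"
    and "sn_tail_shape \<mu> \<omega> l = sn_tail_shape \<mu>' \<omega>' l'"
    and "sn_tail_shape (- \<mu>) \<omega> (- l) = sn_tail_shape (- \<mu>') \<omega>' (- l')"
  shows "\<mu> = \<mu>' \<and> \<omega> = \<omega>' \<and> l = l'"
proof -
  have pos: "1 + x\<^sup>2 > 0" for x :: real by (simp add: add_pos_nonneg)
  have *: "l\<^sup>2 = l'\<^sup>2" if "skew_normal_Gamma \<omega> l = skew_normal_Gamma \<omega> l'"
    using that assms(1) pos[of l] pos[of l'] by (simp add: skew_normal_Gamma_eq field_simps)
  from assms(3,4) consider "l = 0" "l' = 0" | "l > 0" "l' > 0" | "l < 0" "l' < 0"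
    by (auto simp: sn_tail_shape_def split: if_splits)
  then show ?thesis
  proof cases
    case 1
    then show ?thesis using assms by (auto simp: sn_tail_shape_def)
  next
    case 2
    then have "\<mu> = \<mu>'" "\<omega> = \<omega>'" "skew_normal_Gamma \<omega> (- l) = skew_normal_Gamma \<omega>' (- l')"
      using assms by (auto simp: sn_tail_shape_def)
    then show ?thesis using * 2 by (auto simp: skew_normal_Gamma_eq)
  next
    case 3
    then have "\<mu> = \<mu>'" "\<omega> = \<omega>'" "skew_normal_Gamma \<omega> l = skew_normal_Gamma \<omega>' l'"
      using assms by (auto simp: sn_tail_shape_def)
    then show ?thesis using * 3 by (auto simp: power2_eq_iff)
  qed
qed

text \<open>Writing the first density as an equal mixture of itself with itself makes the mixture
  results applicable: both tail shapes agree.\<close>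

lemma skew_normal_pdf_inj:
  assumes \<omega>: "\<omega> > 0" "\<omega>' > 0" and eq: "skew_normal_pdf \<mu> \<omega> l = skew_normal_pdf \<mu>' \<omega>' l'"
  shows "\<mu> = \<mu>' \<and> \<omega> = \<omega>' \<and> l = l'"
proof -
  have half: "1 / 2 * skew_normal_pdf \<mu> \<omega> l x + 1 / 2 * skew_normal_pdf \<mu> \<omega> l x
      = skew_normal_pdf \<mu>' \<omega>' l' x" for x
    by (simp add: eq)
  have "sn_tail_shape \<mu> \<omega> l = sn_tail_shape \<mu>' \<omega>' l'"
    using skew_normal_mixture_right_tail[OF \<omega>(1,1,2) _ _ half] sn_tail_coeff_pos[OF \<omega>(2), of l']
    by (auto split: if_splits)
  moreover have "sn_tail_shape (- \<mu>) \<omega> (- l) = sn_tail_shape (- \<mu>') \<omega>' (- l')"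
    using skew_normal_mixture_left_tail[OF \<omega>(1,1,2) _ _ half] sn_tail_coeff_pos[OF \<omega>(2), of "- l'"]
    by (auto split: if_splits)
  ultimately show ?thesis using sn_tail_shapes_inj[OF \<omega>] by blast
qed

text \<open>Comparing coefficients leaves only the case where a symmetric normal density is split as
  \<open>\<phi> = \<phi> \<Phi>(l \<cdot>) + \<phi> \<Phi>(- l \<cdot>)\<close>, whose two summands have the same \<open>\<Gamma>\<close>.\<close>

lemma skew_normal_mixture_crossed_tails:
  assumes \<omega>: "\<omega>\<^sub>1 > 0" "\<omega>\<^sub>2 > 0" "\<omega>\<^sub>3 > 0" and cd: "0 < c" "0 < d" "c + d = 1"
    and eq: "\<And>x. c * skew_normal_pdf \<mu>\<^sub>1 \<omega>\<^sub>1 l\<^sub>1 x + d * skew_normal_pdf \<mu>\<^sub>2 \<omega>\<^sub>2 l\<^sub>2 x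
      = skew_normal_pdf \<mu>\<^sub>3 \<omega>\<^sub>3 l\<^sub>3 x"
    and R: "sn_tail_shape \<mu>\<^sub>1 \<omega>\<^sub>1 l\<^sub>1 = sn_tail_shape \<mu>\<^sub>3 \<omega>\<^sub>3 l\<^sub>3"
      "c * sn_tail_coeff \<omega>\<^sub>1 l\<^sub>1 = sn_tail_coeff \<omega>\<^sub>3 l\<^sub>3"
    and L: "sn_tail_shape (- \<mu>\<^sub>2) \<omega>\<^sub>2 (- l\<^sub>2) = sn_tail_shape (- \<mu>\<^sub>3) \<omega>\<^sub>3 (- l\<^sub>3)"
      "d * sn_tail_coeff \<omega>\<^sub>2 (- l\<^sub>2) = sn_tail_coeff \<omega>\<^sub>3 (- l\<^sub>3)"
  shows "skew_normal_Gamma \<omega>\<^sub>1 l\<^sub>1 = skew_normal_Gamma \<omega>\<^sub>2 l\<^sub>2"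
proof -
  have cd1: "c < 1" "d < 1" using cd by auto
  have c0: "e * std_normal_cdf 0 \<noteq> 1" if "e < 1" for e
  proof
    assume "e * std_normal_cdf 0 = 1"
    moreover have "e * std_normal_cdf 0 < 1 * std_normal_cdf 0"
      using that std_normal_cdf_pos by (intro mult_strict_right_mono) auto
    ultimately show False using std_normal.cdf_bounded_prob[of 0] by simp
  qed
  \<comment> \<open>For positive \<open>l\<^sub>3\<close> the right coefficients would give
    \<open>c = 1\<close> or \<open>c * std_normal_cdf 0 = 1\<close>. The left tail excludes negative
    \<open>l\<^sub>3\<close> in the same way, with \<open>d\<close>.\<close>
  have "\<not> l\<^sub>3 > 0"
  proof
    assume "l\<^sub>3 > 0"
    moreover from this have "\<not> l\<^sub>1 < 0" "\<omega>\<^sub>1 = \<omega>\<^sub>3"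
      using R(1) \<omega> by (auto simp: sn_tail_shape_def split: if_splits)
    ultimately show False
      using R(2) \<omega> cd1 c0[of c] by (auto simp: sn_tail_coeff_def field_simps split: if_splits)
  qed
  moreover have "\<not> l\<^sub>3 < 0"
  proof
    assume "l\<^sub>3 < 0"
    moreover from this have "\<not> l\<^sub>2 > 0" "\<omega>\<^sub>2 = \<omega>\<^sub>3"
      using L(1) \<omega> by (auto simp: sn_tail_shape_def split: if_splits)
    ultimately show False
      using L(2) \<omega> cd1 c0[of d] by (auto simp: sn_tail_coeff_def field_simps split: if_splits)
  qed
  ultimately have l3: "l\<^sub>3 = 0" by simp
  have par: "\<omega>\<^sub>1 = \<omega>\<^sub>3" "\<mu>\<^sub>1 = \<mu>\<^sub>3" "\<omega>\<^sub>2 = \<omega>\<^sub>3" "\<mu>\<^sub>2 = \<mu>\<^sub>3" "l\<^sub>1 \<ge> 0" "l\<^sub>2 \<le> 0"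
    using R(1) L(1) \<omega> l3 by (auto simp: sn_tail_shape_def split: if_splits)
  \<comment> \<open>Here \<open>l\<^sub>1 = 0\<close> would force \<open>c = 1\<close>, so the first
    component is properly skewed and its limiting factor is 1. Likewise for \<open>l\<^sub>2\<close>
    and \<open>d\<close>.\<close>
  have "c = std_normal_cdf 0"
    using R(2) par l3 \<omega> cd1 std_normal_cdf_pos[of 0]
    by (auto simp: sn_tail_coeff_def field_simps split: if_splits)
  moreover have "d = std_normal_cdf 0"
    using L(2) par l3 \<omega> cd1 std_normal_cdf_pos[of 0]
    by (auto simp: sn_tail_coeff_def field_simps split: if_splits)
  ultimately have half: "c = 1 / 2" "d = 1 / 2" "std_normal_cdf 0 = 1 / 2"
    using cd by auto
  \<comment> \<open>Evaluating the mixture at \<open>\<mu>\<^sub>3 + \<omega>\<^sub>3 * z\<close>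
    makes the normal density factor common to all three terms; it cancels. The derivative of the
    resulting identity at 0 then gives \<open>l\<^sub>1 + l\<^sub>2 = 0\<close>.\<close>
  have sum1: "std_normal_cdf (l\<^sub>1 * z) + std_normal_cdf (l\<^sub>2 * z) = 1" for z
  proof -
    define K where "K = 2 / \<omega>\<^sub>3 * std_normal_density z"
    have "K > 0" using \<omega> by (simp add: K_def normal_density_pos)
    moreover have "1 / 2 * (K * std_normal_cdf (l\<^sub>1 * z)) + 1 / 2 * (K * std_normal_cdf (l\<^sub>2 * z)) = K * (1 / 2)"
      using eq[of "\<mu>\<^sub>3 + \<omega>\<^sub>3 * z"] \<omega> unfolding skew_normal_pdf_def par half l3 K_def
      by (simp add: half)
    then have "K * (std_normal_cdf (l\<^sub>1 * z) + std_normal_cdf (l\<^sub>2 * z)) = K * 1"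
      by (simp add: algebra_simps)
    ultimately show ?thesis by simp
  qed
  have "((\<lambda>z. std_normal_cdf (l\<^sub>1 * z) + std_normal_cdf (l\<^sub>2 * z)) has_real_derivative
      std_normal_density (l\<^sub>1 * 0) * l\<^sub>1 + std_normal_density (l\<^sub>2 * 0) * l\<^sub>2) (at 0)"
    by (auto intro!: derivative_eq_intros DERIV_chain2[OF std_normal_cdf_has_derivative])
  then have "std_normal_density 0 * (l\<^sub>1 + l\<^sub>2) = 0"
    unfolding sum1 using DERIV_unique[OF _ DERIV_const] by (fastforce simp: algebra_simps)
  then have "l\<^sub>2 = - l\<^sub>1"
    using normal_density_pos[of 1 0 0] by (auto simp: std_normal_density_def)
  then show ?thesis using par by (simp add: skew_normal_Gamma_eq)
qed

section \<open>Case analysis on the matching tails, and identifiability\<close>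

lemma skew_normal_mixture_Gamma:
  assumes \<omega>: "\<omega>\<^sub>1 > 0" "\<omega>\<^sub>2 > 0" "\<omega>\<^sub>3 > 0" and cd: "0 < c" "0 < d" "c + d = 1"
    and eq: "\<And>x. c * skew_normal_pdf \<mu>\<^sub>1 \<omega>\<^sub>1 l\<^sub>1 x + d * skew_normal_pdf \<mu>\<^sub>2 \<omega>\<^sub>2 l\<^sub>2 x
      = skew_normal_pdf \<mu>\<^sub>3 \<omega>\<^sub>3 l\<^sub>3 x"
  shows "skew_normal_Gamma \<omega>\<^sub>1 l\<^sub>1 \<in> {skew_normal_Gamma \<omega>\<^sub>2 l\<^sub>2, skew_normal_Gamma \<omega>\<^sub>3 l\<^sub>3}"
proof -
  let ?R1 = "sn_tail_shape \<mu>\<^sub>1 \<omega>\<^sub>1 l\<^sub>1 = sn_tail_shape \<mu>\<^sub>3 \<omega>\<^sub>3 l\<^sub>3"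
  let ?R2 = "sn_tail_shape \<mu>\<^sub>2 \<omega>\<^sub>2 l\<^sub>2 = sn_tail_shape \<mu>\<^sub>3 \<omega>\<^sub>3 l\<^sub>3"
  let ?L1 = "sn_tail_shape (- \<mu>\<^sub>1) \<omega>\<^sub>1 (- l\<^sub>1) = sn_tail_shape (- \<mu>\<^sub>3) \<omega>\<^sub>3 (- l\<^sub>3)"
  let ?L2 = "sn_tail_shape (- \<mu>\<^sub>2) \<omega>\<^sub>2 (- l\<^sub>2) = sn_tail_shape (- \<mu>\<^sub>3) \<omega>\<^sub>3 (- l\<^sub>3)"
  note R = skew_normal_mixture_right_tail[OF \<omega> cd(1,2) eq]
  note L = skew_normal_mixture_left_tail[OF \<omega> cd(1,2) eq]
  \<comment> \<open>Without a matching summand the left-hand side would be 0, but the coefficient of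
    the mixture is positive.\<close>
  have "?R1 \<or> ?R2" "?L1 \<or> ?L2"
    using R L sn_tail_coeff_pos[OF \<omega>(3)] by (auto split: if_splits simp: less_le)
  \<comment> \<open>If no single component matches both tails, each side has exactly one match, so
    the coefficient equations reduce to one term each.\<close>
  then consider "?R1" "?L1" | "?R2" "?L2" | "?R1" "\<not> ?R2" "\<not> ?L1" "?L2" | "\<not> ?R1" "?R2" "?L1" "\<not> ?L2"
    by blast
  then show ?thesis
  proof cases
    case 1
    then show ?thesis using sn_tail_shapes_inj[OF \<omega>(1,3)] by blast
  next
    case 2
    then have p: "\<mu>\<^sub>2 = \<mu>\<^sub>3" "\<omega>\<^sub>2 = \<omega>\<^sub>3" "l\<^sub>2 = l\<^sub>3"
      using sn_tail_shapes_inj[OF \<omega>(2,3)] by blast+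
    have "skew_normal_pdf \<mu>\<^sub>1 \<omega>\<^sub>1 l\<^sub>1 x = skew_normal_pdf \<mu>\<^sub>3 \<omega>\<^sub>3 l\<^sub>3 x" for x
    proof -
      have d: "d = 1 - c" using cd by simp
      have "c * skew_normal_pdf \<mu>\<^sub>1 \<omega>\<^sub>1 l\<^sub>1 x = c * skew_normal_pdf \<mu>\<^sub>3 \<omega>\<^sub>3 l\<^sub>3 x"
        using eq[of x] unfolding p d by (simp add: left_diff_distrib)
      then show ?thesis using cd by simp
    qed
    then show ?thesis using skew_normal_pdf_inj[OF \<omega>(1,3)] by blast
  next
    case 3
    then have "skew_normal_Gamma \<omega>\<^sub>1 l\<^sub>1 = skew_normal_Gamma \<omega>\<^sub>2 l\<^sub>2"
      using R L by (intro skew_normal_mixture_crossed_tails[OF \<omega> cd eq]) auto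
    then show ?thesis by simp
  next
    case 4
    have "d + c = 1" using cd by simp
    moreover have "d * skew_normal_pdf \<mu>\<^sub>2 \<omega>\<^sub>2 l\<^sub>2 x + c * skew_normal_pdf \<mu>\<^sub>1 \<omega>\<^sub>1 l\<^sub>1 x
        = skew_normal_pdf \<mu>\<^sub>3 \<omega>\<^sub>3 l\<^sub>3 x" for x
      using eq[of x] by simp
    ultimately have "skew_normal_Gamma \<omega>\<^sub>2 l\<^sub>2 = skew_normal_Gamma \<omega>\<^sub>1 l\<^sub>1"
      using R L 4 by (intro skew_normal_mixture_crossed_tails[OF \<omega>(2,1,3) cd(2,1)]) auto
    then show ?thesis by simp
  qed
qed

theorem theorem1:
  fixes \<mu>\<^sub>1 \<omega>\<^sub>1 l\<^sub>1 :: real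
  assumes "\<omega>\<^sub>1 > 0"
  shows "identifiable_mixtures
           {skew_normal_pdf \<mu> \<omega> l | \<mu> \<omega> l.
              \<omega> > 0 \<and> skew_normal_Gamma \<omega> l \<noteq> skew_normal_Gamma \<omega>\<^sub>1 l\<^sub>1}
           (skew_normal_pdf \<mu>\<^sub>1 \<omega>\<^sub>1 l\<^sub>1)"
    (is "identifiable_mixtures ?P ?f")
proof -
  \<comment> \<open>The hypotheses are symmetric in the two mixtures, so excluding
    \<open>a < b\<close> and applying this again with the roles exchanged gives
    \<open>a = b\<close>.\<close>
  have not_less: "\<not> a < b"
    if ab: "a \<in> {0<..<1}" "b \<in> {0<..<1}" and hg: "h \<in> ?P" "g \<in> ?P"
      and eq: "mixture ?f a h = mixture ?f b g" for a b h g
  proof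
    assume "a < b"
    obtain \<mu> \<omega> l where h: "h = skew_normal_pdf \<mu> \<omega> l" "\<omega> > 0"
      "skew_normal_Gamma \<omega> l \<noteq> skew_normal_Gamma \<omega>\<^sub>1 l\<^sub>1" using hg(1) by auto
    obtain \<mu>' \<omega>' l' where g: "g = skew_normal_pdf \<mu>' \<omega>' l'" "\<omega>' > 0"
      "skew_normal_Gamma \<omega>' l' \<noteq> skew_normal_Gamma \<omega>\<^sub>1 l\<^sub>1" using hg(2) by auto
    \<comment> \<open>Solving for \<open>h\<close>: the weights are positive because
      \<open>a < b < 1\<close>, and they sum to 1.\<close>
    have *: "(b - a) / (1 - a) * ?f x + (1 - b) / (1 - a) * g x = h x" for x
    proof -
      have "(b - a) * ?f x + (1 - b) * g x = (1 - a) * h x"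
        using fun_cong[OF eq, of x] by (simp add: mixture_def algebra_simps)
      then show ?thesis
        using ab by (simp add: eq_divide_eq mult.commute flip: add_divide_distrib)
    qed
    have "skew_normal_Gamma \<omega>\<^sub>1 l\<^sub>1 \<in> {skew_normal_Gamma \<omega>' l', skew_normal_Gamma \<omega> l}"
    proof (rule skew_normal_mixture_Gamma[OF assms g(2) h(2)])
      show "(b - a) / (1 - a) * ?f x + (1 - b) / (1 - a) * skew_normal_pdf \<mu>' \<omega>' l' x
          = skew_normal_pdf \<mu> \<omega> l x" for x
        using *[of x] unfolding h(1) g(1) .
    qed (use ab \<open>a < b\<close> in \<open>auto simp: field_simps\<close>)
    then show False using h(3) g(3) by auto
  qed
  have "(a, h) = (b, g)"
    if "a \<in> {0<..<1}" "b \<in> {0<..<1}" "h \<in> ?P" "g \<in> ?P"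
      and eq: "mixture ?f a h = mixture ?f b g" for a b h g
  proof -
    have "a = b"
      using not_less[OF that] not_less[OF that(2,1,4,3) eq[symmetric]] by linarith
    moreover have "h x = g x" for x
      using fun_cong[OF eq, of x] that(1) \<open>a = b\<close> by (simp add: mixture_def)
    ultimately show ?thesis by auto
  qed
  then show ?thesis unfolding identifiable_mixtures_def by blast
qed

end
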